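(* Let $J\subseteq\mathbb{R}$ be a non-degenerate interval and let $f\colon J\to\mathbb{R}$ be bounded on compacts. Then $f$ is Riemann integrable on every compact subinterval of $J$ if and only if the pre-primitives of $f$ in $J$ are Riemann's primitives of $f$ in $J$ (that is, any two pre-primitives of $f$ in $J$ differ by a constant on $J$). Moreover, if $f$ is Riemann integrable on every compact subinterval of $J$ and $a,b\in J$, then $$\int_a^b f(x)\,dx = F(b)-F(a),$$ where $F$ is any Riemann's primitive of $f$ in $J$.
   Context: A function $f\colon J\to\mathbb{R}$ on a non-degenerate interval $J\subseteq\mathbb{R}$ is called bounded on compacts if its restriction to every compact subinterval of $J$ is bounded. If $f\colon J\to\mathbb{R}$ is bounded on compacts, a function $F\colon J\to\mathbb{R}$ is a pre-primitive of $f$ in $J$ if for all $x,y\in J$ with $x\neq y$, the quotient $\frac{F(y)-F(x)}{y-x}$ lies between each pair of lower and upper bounds for $f$ on the compact subinterval of $J$ with endpoints $x,y$; that is, whenever $p,q\in\mathbb{R}$ satisfy $p\le f(t)\le q$ for all $t$ in that subinterval, one has $p\le \frac{F(y)-F(x)}{y-x}\le q$. The pre-primitives of $f$ in $J$ are called Riemann's primitives (or $\mathcal{R}$-primitives) of $f$ in $J$ if they differ in constants, i.e. if for any two pre-primitives $F,G$ of $f$ in $J$ the function $F-G$ is constant on $J$. Riemann integrability on $[a,b]$ (with $a<b$) is in the Darboux sense: the supremum of the lower sums $\sum_{i=1}^n p_i(x_i-x_{i-1})$ equals the infimum of the upper sums $\sum_{i=1}^n q_i(x_i-x_{i-1})$,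 where $a=x_0\le x_1\le\dots\le x_n=b$ and $p_i$, $q_i$ are any lower, respectively upper, bounds of $f$ on $[x_{i-1},x_i]$; the integral $\int_a^b f(x)\,dx$ is the common value. As usual, $\int_a^a f(x)\,dx=0$ and $\int_a^b f(x)\,dx=-\int_b^a f(x)\,dx$ if $a>b$. *)

theory Defs
  imports "HOL-Analysis.Analysis"
begin

text \<open>
  A function on an interval \<open>J\<close> is represented by a total function \<open>real \<Rightarrow> real\<close>; the notions below
  depend only on its values on \<open>J\<close> (or on the compact interval considered).
\<close>

definition nondegenerate_interval :: "real set \<Rightarrow> bool" where
  "nondegenerate_interval J \<longleftrightarrow> is_interval J \<and> (\<exists>x\<in>J. \<exists>y\<in>J. x \<noteq> y)"

definition bounded_on_compacts :: "(real \<Rightarrow> real) \<Rightarrow> real set \<Rightarrow> bool" where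
  "bounded_on_compacts f J \<longleftrightarrow> (\<forall>a b. a \<le> b \<and> {a..b} \<subseteq> J \<longrightarrow> bounded (f ` {a..b}))"

definition pre_primitive :: "(real \<Rightarrow> real) \<Rightarrow> real set \<Rightarrow> (real \<Rightarrow> real) \<Rightarrow> bool" where
  "pre_primitive f J F \<longleftrightarrow>
     (\<forall>x\<in>J. \<forall>y\<in>J. x \<noteq> y \<longrightarrow>
       (\<forall>p q. (\<forall>t\<in>closed_segment x y. p \<le> f t \<and> f t \<le> q) \<longrightarrow>
          p \<le> (F y - F x) / (y - x) \<and> (F y - F x) / (y - x) \<le> q))"

definition pre_primitives_are_riemann :: "(real \<Rightarrow> real) \<Rightarrow> real set \<Rightarrow> bool" where
  "pre_primitives_are_riemann f J \<longleftrightarrow>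
     (\<forall>F G. pre_primitive f J F \<and> pre_primitive f J G \<longrightarrow> (\<lambda>x. F x - G x) constant_on J)"

definition riemann_primitive :: "(real \<Rightarrow> real) \<Rightarrow> real set \<Rightarrow> (real \<Rightarrow> real) \<Rightarrow> bool" where
  "riemann_primitive f J F \<longleftrightarrow> pre_primitives_are_riemann f J \<and> pre_primitive f J F"

definition subdivision :: "real \<Rightarrow> real \<Rightarrow> nat \<Rightarrow> (nat \<Rightarrow> real) \<Rightarrow> bool" where
  "subdivision a b n x \<longleftrightarrow> x 0 = a \<and> x n = b \<and> (\<forall>i\<in>{1..n}. x (i - 1) \<le> x i)"

definition lower_sums :: "(real \<Rightarrow> real) \<Rightarrow> real \<Rightarrow> real \<Rightarrow> real set" where
  "lower_sums f a b =
     {\<Sum>i=1..n. p i * (x i - x (i - 1)) | n x p.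
        subdivision a b n x \<and> (\<forall>i\<in>{1..n}. \<forall>t\<in>{x (i - 1)..x i}. p i \<le> f t)}"

definition upper_sums :: "(real \<Rightarrow> real) \<Rightarrow> real \<Rightarrow> real \<Rightarrow> real set" where
  "upper_sums f a b =
     {\<Sum>i=1..n. q i * (x i - x (i - 1)) | n x q.
        subdivision a b n x \<and> (\<forall>i\<in>{1..n}. \<forall>t\<in>{x (i - 1)..x i}. f t \<le> q i)}"

text \<open>
  Boundedness makes both sets of sums nonempty and bounded on the relevant side, so that \<open>Sup\<close> and
  \<open>Inf\<close>, which are unspecified on other sets of reals, are the true supremum and infimum.
\<close>

definition darboux_integrable :: "(real \<Rightarrow> real) \<Rightarrow> real \<Rightarrow> real \<Rightarrow> bool" where
  "darboux_integrable f a b \<longleftrightarrow>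
     a < b \<and> bounded (f ` {a..b}) \<and> Sup (lower_sums f a b) = Inf (upper_sums f a b)"

definition darboux_integral :: "(real \<Rightarrow> real) \<Rightarrow> real \<Rightarrow> real \<Rightarrow> real" where
  "darboux_integral f a b =
     (if a < b then Sup (lower_sums f a b)
      else if a = b then 0
      else - Sup (lower_sums f b a))"

definition darboux_integrable_on_compacts :: "(real \<Rightarrow> real) \<Rightarrow> real set \<Rightarrow> bool" where
  "darboux_integrable_on_compacts f J \<longleftrightarrow>
     (\<forall>a b. a < b \<and> {a..b} \<subseteq> J \<longrightarrow> darboux_integrable f a b)"

end

theory Submission
  imports Defs
begin

text \<open>
  On a compact interval every pre-primitive \<open>F\<close> of \<open>f\<close> is squeezed between the Darboux sums: on each
  piece of a subdivision the increment of \<open>F\<close> dominates \<open>p i\<close> times the length of the piece, so by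
  telescoping \<open>F b - F a\<close> is above every lower sum and, dually, below every upper sum
  (\<open>lower_integral_le_increment\<close>, \<open>increment_le_upper_integral\<close>).  If the lower and the upper
  integral agree, the increments of \<open>F\<close> are forced to be the integral; this gives uniqueness up
  to constants and the formula for the integral.

  Conversely, the lower and the upper integral are themselves increments of pre-primitives.  The
  lower integral is additive in the interval (\<open>lower_integral_additive\<close>), because subdivisions can
  be glued at a common endpoint and cut at an interior point.  Hence the signed lower integral from
  a base point has the lower integral over \<open>[x, y]\<close> as its increment, and this lies between the
  trivial bounds, so it is a pre-primitive (\<open>pre_primitive_signed_lower_integral\<close>).  Applied to
  \<open>-f\<close>, the same construction produces, after a change of sign, a pre-primitive of \<open>f\<close> whose
  increments are the upper integrals.  If these two functions differ by a constant, lower and upper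
  integrals coincide on every compact subinterval.
\<close>

section \<open>Subdivisions and the bounds on lower sums\<close>

lemma subdivision_mono:
  assumes "subdivision a b n x" "i \<le> j" "j \<le> n"
  shows "x i \<le> x j"
  using assms(2,3)
proof (induction j rule: dec_induct)
  case (step k)
  have "x k \<le> x (Suc k)"
    using assms(1) step.prems bspec[of "{1..n}" "\<lambda>i. x (i - 1) \<le> x i" "Suc k"]
    by (simp add: subdivision_def)
  with step show ?case by simp
qed simp

lemma subdivision_piece:
  assumes "subdivision a b n x" "i \<in> {1..n}"
  shows "a \<le> x (i - 1)" "x (i - 1) \<le> x i" "x i \<le> b"
  using subdivision_mono[OF assms(1), of 0 "i - 1"] subdivision_mono[OF assms(1), of i n]
    subdivision_mono[OF assms(1), of "i - 1" i] assms
  by (auto simp: subdivision_def)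

lemma constant_lower_sum:
  assumes "a \<le> b" "\<forall>t\<in>{a..b}. p \<le> f t"
  shows "p * (b - a) \<in> lower_sums f a b"
  unfolding lower_sums_def mem_Collect_eq
  by (rule exI[of _ 1], rule exI[of _ "\<lambda>i. if i = 0 then a else b"], rule exI[of _ "\<lambda>_. p"])
    (use assms in \<open>auto simp: subdivision_def\<close>)

text \<open>
  The telescoping argument.  It is stated for an arbitrary \<open>F\<close> because two instances are needed:
  pre-primitives of \<open>f\<close>, and the linear functions with slope an upper bound of \<open>f\<close>.
\<close>

lemma lower_sum_le_increment:
  assumes "s \<in> lower_sums f a b"
    and step: "\<And>u v p. a \<le> u \<Longrightarrow> u \<le> v \<Longrightarrow> v \<le> b \<Longrightarrow> \<forall>t\<in>{u..v}. p \<le> f t \<Longrightarrow> p * (v - u) \<le> F v - F u"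
  shows "s \<le> F b - F a"
proof -
  obtain n x p where s: "s = (\<Sum>i=1..n. p i * (x i - x (i - 1)))" and sd: "subdivision a b n x"
    and p: "\<forall>i\<in>{1..n}. \<forall>t\<in>{x (i - 1)..x i}. p i \<le> f t"
    using assms(1) unfolding lower_sums_def by blast
  have "s \<le> (\<Sum>i=1..n. F (x i) - F (x (i - 1)))"
    unfolding s by (intro sum_mono step subdivision_piece[OF sd]) (use p in auto)
  also have "\<dots> = F (x n) - F (x 0)"
    by (induction n) auto
  finally show ?thesis
    using sd by (simp add: subdivision_def)
qed

lemma lower_sum_le_constant:
  assumes "s \<in> lower_sums f a b" "\<forall>t\<in>{a..b}. f t \<le> q"
  shows "s \<le> q * (b - a)"
proof -
  have "s \<le> q * b - q * a"
  proof (rule lower_sum_le_increment[OF assms(1)])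
    fix u v p
    assume uv: "a \<le> u" "u \<le> v" "v \<le> b" and p: "\<forall>t\<in>{u..v}. p \<le> f t"
    have "p \<le> f u" "f u \<le> q"
      using uv p assms(2) by auto
    then have "p * (v - u) \<le> q * (v - u)"
      using uv by (intro mult_right_mono) auto
    then show "p * (v - u) \<le> q * v - q * u"
      by (simp add: algebra_simps)
  qed
  then show ?thesis by (simp add: algebra_simps)
qed

lemma bounded_image_bounds:
  fixes f :: "real \<Rightarrow> real"
  assumes "bounded (f ` S)"
  obtains p q where "\<And>t. t \<in> S \<Longrightarrow> p \<le> f t \<and> f t \<le> q"
proof -
  obtain M where "\<And>t. t \<in> S \<Longrightarrow> \<bar>f t\<bar> \<le> M"
    using assms unfolding bounded_iff by auto
  then show thesis
    by (intro that[of "- M" M]) (simp add: abs_le_iff minus_le_iff)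
qed

lemma lower_sums_nonempty:
  assumes "a \<le> b" "bounded (f ` {a..b})"
  shows "lower_sums f a b \<noteq> {}"
proof -
  obtain p q where "\<And>t. t \<in> {a..b} \<Longrightarrow> p \<le> f t \<and> f t \<le> q"
    using bounded_image_bounds[OF assms(2)] by blast
  then show ?thesis
    using constant_lower_sum[OF assms(1), of p f] by blast
qed

lemma lower_sums_bdd_above:
  assumes "bounded (f ` {a..b})"
  shows "bdd_above (lower_sums f a b)"
proof -
  obtain p q where "\<And>t. t \<in> {a..b} \<Longrightarrow> p \<le> f t \<and> f t \<le> q"
    using bounded_image_bounds[OF assms] by blast
  then show ?thesis
    by (intro bdd_aboveI[of _ "q * (b - a)"] lower_sum_le_constant) auto
qed

lemma uminus_upper_sums: "uminus ` upper_sums f a b = lower_sums (\<lambda>t. - f t) a b"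
proof (intro equalityI subsetI)
  fix s assume "s \<in> uminus ` upper_sums f a b"
  then obtain n x q where "s = - (\<Sum>i=1..n. q i * (x i - x (i - 1)))" "subdivision a b n x"
    "\<forall>i\<in>{1..n}. \<forall>t\<in>{x (i - 1)..x i}. f t \<le> q i"
    unfolding upper_sums_def by blast
  then show "s \<in> lower_sums (\<lambda>t. - f t) a b"
    unfolding lower_sums_def mem_Collect_eq
    by (intro exI[of _ n] exI[of _ x] exI[of _ "\<lambda>i. - q i"]) (simp add: sum_negf)
next
  fix s assume "s \<in> lower_sums (\<lambda>t. - f t) a b"
  then obtain n x p where *: "s = (\<Sum>i=1..n. p i * (x i - x (i - 1)))" "subdivision a b n x"
    "\<forall>i\<in>{1..n}. \<forall>t\<in>{x (i - 1)..x i}. p i \<le> - f t"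
    unfolding lower_sums_def by blast
  have "- s \<in> upper_sums f a b"
    unfolding upper_sums_def mem_Collect_eq using *
    by (intro exI[of _ n] exI[of _ x] exI[of _ "\<lambda>i. - p i"]) (auto simp: sum_negf le_minus_iff)
  then show "s \<in> uminus ` upper_sums f a b"
    by (metis image_eqI minus_minus)
qed

text \<open>
  Through this duality additivity and the comparison with pre-primitives are proved for lower
  integrals only; the facts about upper integrals are the same facts for \<open>-f\<close>.
\<close>

lemma upper_integral_eq_uminus_lower:
  "Inf (upper_sums f a b) = - Sup (lower_sums (\<lambda>t. - f t) a b)"
  by (simp add: Inf_real_def uminus_upper_sums)

section \<open>Additivity of the lower integral\<close>

lemma lower_sums_glue:
  assumes "s \<in> lower_sums f a b" "s' \<in> lower_sums f b c"
  shows "s + s' \<in> lower_sums f a c"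
proof -
  obtain n x p where s: "s = (\<Sum>i=1..n. p i * (x i - x (i - 1)))" and x: "subdivision a b n x"
    and p: "\<forall>i\<in>{1..n}. \<forall>t\<in>{x (i - 1)..x i}. p i \<le> f t"
    using assms(1) unfolding lower_sums_def by blast
  obtain m y q where s': "s' = (\<Sum>i=1..m. q i * (y i - y (i - 1)))" and y: "subdivision b c m y"
    and q: "\<forall>i\<in>{1..m}. \<forall>t\<in>{y (i - 1)..y i}. q i \<le> f t"
    using assms(2) unfolding lower_sums_def by blast
  define z where "z i = (if i \<le> n then x i else y (i - n))" for i
  define r where "r i = (if i \<le> n then p i else q (i - n))" for i
  have left: "z i = x i" "z (i - 1) = x (i - 1)" "r i = p i" if "i \<in> {1..n}" for i
    using that by (auto simp: z_def r_def)
  \<comment> \<open>At \<open>j = 1\<close> the left endpoint is \<open>z n = x n\<close>, which agrees with \<open>y 0\<close>.\<close>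
  have right: "z (j + n) = y j" "z (j + n - 1) = y (j - 1)" "r (j + n) = q j" if "j \<in> {1..m}" for j
  proof -
    show "z (j + n) = y j" "r (j + n) = q j"
      using that by (auto simp: z_def r_def)
    show "z (j + n - 1) = y (j - 1)"
      using that x y by (cases "j = 1") (auto simp: z_def subdivision_def)
  qed
  have pieces: "P" if "i \<in> {1..n + m}" "i \<in> {1..n} \<Longrightarrow> P"
    "\<And>j. j \<in> {1..m} \<Longrightarrow> i = j + n \<Longrightarrow> P" for i P
  proof (cases "i \<le> n")
    case False
    then show ?thesis
      using that(1) by (intro that(3)[of "i - n"]) auto
  qed (use that in auto)
  have "z 0 = a" "z (n + m) = c"
    using x y by (auto simp: z_def subdivision_def)
  moreover have "z (i - 1) \<le> z i" if "i \<in> {1..n + m}" for i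
    using that
    by (rule pieces) (use x y in \<open>auto simp: left right subdivision_def simp del: One_nat_def\<close>)
  ultimately have "subdivision a c (n + m) z"
    by (simp add: subdivision_def)
  moreover have "\<forall>t\<in>{z (i - 1)..z i}. r i \<le> f t" if "i \<in> {1..n + m}" for i
    using that
    by (rule pieces) (use p q in \<open>auto simp: left right simp del: One_nat_def\<close>)
  moreover have "(\<Sum>i=1..n + m. r i * (z i - z (i - 1))) = s + s'"
  proof -
    have "(\<Sum>i=1..n + m. r i * (z i - z (i - 1))) =
      (\<Sum>i=1..n. r i * (z i - z (i - 1))) + (\<Sum>i=1 + n..m + n. r i * (z i - z (i - 1)))"
      using sum.ub_add_nat[of 1 n "\<lambda>i. r i * (z i - z (i - 1))" m] by (simp add: add.commute)
    also have "(\<Sum>i=1..n. r i * (z i - z (i - 1))) = s"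
      unfolding s by (intro sum.cong) (simp_all add: left del: One_nat_def)
    also have "(\<Sum>i=1 + n..m + n. r i * (z i - z (i - 1))) = s'"
      unfolding s' sum.shift_bounds_cl_nat_ivl
      by (intro sum.cong) (simp_all add: right del: One_nat_def)
    finally show ?thesis .
  qed
  ultimately show ?thesis
    unfolding lower_sums_def mem_Collect_eq
    by (intro exI[of _ "n + m"] exI[of _ z] exI[of _ r]) auto
qed

text \<open>
  Clamping all points of a subdivision to \<open>[a, b]\<close> and to \<open>[b, c]\<close> cuts it at \<open>b\<close> without renumbering:
  pieces on the wrong side collapse to the single point \<open>b\<close>, where \<open>f b\<close> serves as the lower bound
  and the length \<open>0\<close> removes the term from the sum.
\<close>

lemma lower_sums_cut:
  assumes "s \<in> lower_sums f a c" "a \<le> b" "b \<le> c"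
  obtains u v where "u \<in> lower_sums f a b" "v \<in> lower_sums f b c" "s = u + v"
proof -
  obtain n x p where s: "s = (\<Sum>i=1..n. p i * (x i - x (i - 1)))" and x: "subdivision a c n x"
    and p: "\<forall>i\<in>{1..n}. \<forall>t\<in>{x (i - 1)..x i}. p i \<le> f t"
    using assms(1) unfolding lower_sums_def by blast
  define y where "y i = min (x i) b" for i
  define z where "z i = max (x i) b" for i
  define g where "g i = (if x (i - 1) \<le> b then p i else f b)" for i
  define h where "h i = (if b \<le> x i then p i else f b)" for i
  have "subdivision a b n y" "subdivision b c n z"
    using x assms(2,3) by (fastforce simp: y_def z_def subdivision_def)+
  moreover have "\<forall>t\<in>{y (i - 1)..y i}. g i \<le> f t" "\<forall>t\<in>{z (i - 1)..z i}. h i \<le> f t"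
    if "i \<in> {1..n}" for i
    using p that subdivision_piece[OF x that]
    by (auto simp: y_def z_def g_def h_def min_def max_def split: if_splits)
  ultimately have "(\<Sum>i=1..n. g i * (y i - y (i - 1))) \<in> lower_sums f a b"
    "(\<Sum>i=1..n. h i * (z i - z (i - 1))) \<in> lower_sums f b c"
    unfolding lower_sums_def by blast+
  moreover have "s = (\<Sum>i=1..n. g i * (y i - y (i - 1))) + (\<Sum>i=1..n. h i * (z i - z (i - 1)))"
    unfolding s sum.distrib[symmetric]
  proof (rule sum.cong[OF refl])
    fix i assume "i \<in> {1..n}"
    from subdivision_piece(2)[OF x this]
    show "p i * (x i - x (i - 1)) = g i * (y i - y (i - 1)) + h i * (z i - z (i - 1))"
      by (auto simp: y_def z_def g_def h_def min_def max_def algebra_simps)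
  qed
  ultimately show thesis by (rule that)
qed

lemma lower_integral_additive:
  assumes "a \<le> b" "b \<le> c" "bounded (f ` {a..c})"
  shows "Sup (lower_sums f a c) = Sup (lower_sums f a b) + Sup (lower_sums f b c)"
proof (rule antisym)
  have bd: "bounded (f ` {a..b})" "bounded (f ` {b..c})"
    using assms by (auto intro: bounded_subset[OF assms(3)])
  note ne = lower_sums_nonempty[OF assms(1) bd(1)] lower_sums_nonempty[OF assms(2) bd(2)]
    lower_sums_nonempty[OF order_trans[OF assms(1,2)] assms(3)]
  note ba = lower_sums_bdd_above[OF bd(1)] lower_sums_bdd_above[OF bd(2)]
    lower_sums_bdd_above[OF assms(3)]
  show "Sup (lower_sums f a c) \<le> Sup (lower_sums f a b) + Sup (lower_sums f b c)"
  proof (rule cSup_least[OF ne(3)])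
    fix s assume "s \<in> lower_sums f a c"
    then obtain u v where "u \<in> lower_sums f a b" "v \<in> lower_sums f b c" "s = u + v"
      using assms(1,2) by (rule lower_sums_cut)
    then show "s \<le> Sup (lower_sums f a b) + Sup (lower_sums f b c)"
      by (metis add_mono cSup_upper ba(1,2))
  qed
  have "u + v \<le> Sup (lower_sums f a c)" if "u \<in> lower_sums f a b" "v \<in> lower_sums f b c" for u v
    by (rule cSup_upper[OF lower_sums_glue[OF that] ba(3)])
  then have "u \<le> Sup (lower_sums f a c) - Sup (lower_sums f b c)" if "u \<in> lower_sums f a b" for u
    using that cSup_least[OF ne(2), of "Sup (lower_sums f a c) - u"] by (fastforce simp: algebra_simps)
  then have "Sup (lower_sums f a b) \<le> Sup (lower_sums f a c) - Sup (lower_sums f b c)"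
    using ne(1) by (intro cSup_least)
  then show "Sup (lower_sums f a b) + Sup (lower_sums f b c) \<le> Sup (lower_sums f a c)"
    by simp
qed

section \<open>Pre-primitives and Darboux integrals\<close>

lemma interval_contains_Icc:
  fixes J :: "real set"
  assumes "is_interval J" "a \<in> J" "b \<in> J"
  shows "{a..b} \<subseteq> J"
  using assms by (meson atLeastAtMost_iff mem_is_interval_1_I subsetI)

lemma bounded_on_compacts_Icc:
  assumes "is_interval J" "bounded_on_compacts f J" "a \<in> J" "b \<in> J"
  shows "bounded (f ` {a..b})"
proof (cases "a \<le> b")
  case True
  then show ?thesis
    using assms(2) interval_contains_Icc[OF assms(1,3,4)] unfolding bounded_on_compacts_def by blast
qed simp

lemma pre_primitive_uminus:
  assumes "pre_primitive (\<lambda>t. - f t) J F"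
  shows "pre_primitive f J (\<lambda>x. - F x)"
  unfolding pre_primitive_def
proof (intro ballI impI allI)
  fix x y p q
  assume xy: "x \<in> J" "y \<in> J" "x \<noteq> y" and "\<forall>t\<in>closed_segment x y. p \<le> f t \<and> f t \<le> q"
  then have "\<forall>t\<in>closed_segment x y. - q \<le> - f t \<and> - f t \<le> - p"
    by auto
  then have "- q \<le> (F y - F x) / (y - x) \<and> (F y - F x) / (y - x) \<le> - p"
    using assms xy unfolding pre_primitive_def by blast
  moreover have "(- F y - - F x) / (y - x) = - ((F y - F x) / (y - x))"
    by (simp add: minus_divide_left)
  ultimately show "p \<le> (- F y - - F x) / (y - x) \<and> (- F y - - F x) / (y - x) \<le> q"
    by linarith
qed

lemma lower_integral_le_increment:
  assumes "pre_primitive f J F" "{a..b} \<subseteq> J" "a \<le> b" "bounded (f ` {a..b})"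
  shows "Sup (lower_sums f a b) \<le> F b - F a"
proof (rule cSup_least[OF lower_sums_nonempty[OF assms(3,4)]])
  \<comment> \<open>Pre-primitives respect pairs of bounds, so a lower bound \<open>p\<close> needs an upper one beside it.\<close>
  obtain r q where q: "\<And>t. t \<in> {a..b} \<Longrightarrow> r \<le> f t \<and> f t \<le> q"
    using bounded_image_bounds[OF assms(4)] by blast
  fix s assume "s \<in> lower_sums f a b"
  then show "s \<le> F b - F a"
  proof (rule lower_sum_le_increment)
    fix u v p
    assume uv: "a \<le> u" "u \<le> v" "v \<le> b" and p: "\<forall>t\<in>{u..v}. p \<le> f t"
    show "p * (v - u) \<le> F v - F u"
    proof (cases "u = v")
      case False
      have "u \<in> J" "v \<in> J"
        using uv assms(2) by auto
      moreover have "\<forall>t\<in>closed_segment u v. p \<le> f t \<and> f t \<le> q"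
        using uv p q by (auto simp: closed_segment_eq_real_ivl)
      ultimately have "p \<le> (F v - F u) / (v - u)"
        using assms(1) False unfolding pre_primitive_def by blast
      then show ?thesis
        using uv False by (simp add: pos_le_divide_eq)
    qed simp
  qed
qed

lemma increment_le_upper_integral:
  assumes "pre_primitive f J F" "{a..b} \<subseteq> J" "a \<le> b" "bounded (f ` {a..b})"
  shows "F b - F a \<le> Inf (upper_sums f a b)"
proof -
  have "pre_primitive (\<lambda>t. - f t) J (\<lambda>x. - F x)"
    using pre_primitive_uminus[of "\<lambda>t. - f t"] assms(1) by simp
  moreover have "bounded ((\<lambda>t. - f t) ` {a..b})"
    using assms(4) by (simp add: image_image[symmetric])
  ultimately have "Sup (lower_sums (\<lambda>t. - f t) a b) \<le> - F b - - F a"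
    using assms(2,3) by (intro lower_integral_le_increment)
  then show ?thesis
    by (simp add: upper_integral_eq_uminus_lower)
qed

lemma darboux_integral_eq_increment:
  assumes "is_interval J" "darboux_integrable_on_compacts f J" "pre_primitive f J F"
    and "a \<in> J" "b \<in> J"
  shows "darboux_integral f a b = F b - F a"
proof -
  have increment: "Sup (lower_sums f u v) = F v - F u" if "u < v" "u \<in> J" "v \<in> J" for u v
  proof -
    have sub: "{u..v} \<subseteq> J"
      by (rule interval_contains_Icc[OF assms(1) that(2,3)])
    then have "bounded (f ` {u..v})" "Sup (lower_sums f u v) = Inf (upper_sums f u v)"
      using assms(2) that by (auto simp: darboux_integrable_on_compacts_def darboux_integrable_def)
    then show ?thesis
      using lower_integral_le_increment[OF assms(3) sub] increment_le_upper_integral[OF assms(3) sub]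
        that by fastforce
  qed
  show ?thesis
    using assms(4,5) increment[of a b] increment[of b a] by (auto simp: darboux_integral_def)
qed

text \<open>
  For an arbitrary function bounded on compacts, \<open>darboux_integral f c\<close> is the signed \<^emph>\<open>lower\<close>
  integral with base point \<open>c\<close>; the base point drops out of its increments.
\<close>

lemma signed_lower_integral_increment:
  assumes "is_interval J" "bounded_on_compacts f J" "c \<in> J" "x \<in> J" "y \<in> J" "x < y"
  shows "darboux_integral f c y - darboux_integral f c x = Sup (lower_sums f x y)"
proof -
  have add: "Sup (lower_sums f u w) = Sup (lower_sums f u v) + Sup (lower_sums f v w)"
    if "u \<in> J" "w \<in> J" "u \<le> v" "v \<le> w" for u v w
    using that bounded_on_compacts_Icc[OF assms(1,2) that(1,2)] by (intro lower_integral_additive)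
  \<comment> \<open>Degenerate instances of additivity show that the lower integral over a point is \<open>0\<close>.\<close>
  have point: "Sup (lower_sums f u u) = 0" if "u \<in> J" for u
    using that add[of u u u] by simp
  consider "c \<le> x" | "x < c" "c \<le> y" | "y < c" by linarith
  then show ?thesis
  proof cases
    case 1
    then show ?thesis
      using assms(3-6) add[of c y x] point by (simp add: darboux_integral_def)
  next
    case 2
    then show ?thesis
      using assms(3-6) add[of x y c] point by (simp add: darboux_integral_def)
  next
    case 3
    then show ?thesis
      using assms(3-6) add[of x c y] by (simp add: darboux_integral_def)
  qed
qed

lemma pre_primitive_signed_lower_integral:
  assumes "is_interval J" "bounded_on_compacts f J" "c \<in> J"
  shows "pre_primitive f J (darboux_integral f c)"
proof -
  let ?F = "darboux_integral f c"
  have ordered: "p \<le> (?F y - ?F x) / (y - x) \<and> (?F y - ?F x) / (y - x) \<le> q"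
    if xy: "x \<in> J" "y \<in> J" "x < y" and pq: "\<forall>t\<in>{x..y}. p \<le> f t \<and> f t \<le> q" for x y p q
  proof -
    note bd = bounded_on_compacts_Icc[OF assms(1,2) xy(1,2)]
    have "p * (y - x) \<le> Sup (lower_sums f x y)"
      using xy pq by (intro cSup_upper constant_lower_sum lower_sums_bdd_above[OF bd]) auto
    moreover have "Sup (lower_sums f x y) \<le> q * (y - x)"
      using xy pq by (intro cSup_least lower_sums_nonempty bd lower_sum_le_constant) auto
    ultimately show ?thesis
      using xy signed_lower_integral_increment[OF assms xy]
      by (simp add: pos_le_divide_eq pos_divide_le_eq)
  qed
  show ?thesis
    unfolding pre_primitive_def
  proof (intro ballI impI allI)
    fix x y p q
    assume xy: "x \<in> J" "y \<in> J" "x \<noteq> y" and pq: "\<forall>t\<in>closed_segment x y. p \<le> f t \<and> f t \<le> q"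
    consider "x < y" | "y < x" using xy(3) by linarith
    then show "p \<le> (?F y - ?F x) / (y - x) \<and> (?F y - ?F x) / (y - x) \<le> q"
    proof cases
      case 1
      then show ?thesis
        using xy pq by (intro ordered) (auto simp: closed_segment_eq_real_ivl)
    next
      case 2
      have "(?F y - ?F x) / (y - x) = (?F x - ?F y) / (x - y)"
        by (metis minus_diff_eq minus_divide_divide)
      moreover have "p \<le> (?F x - ?F y) / (x - y) \<and> (?F x - ?F y) / (x - y) \<le> q"
        using 2 xy pq by (intro ordered) (auto simp: closed_segment_eq_real_ivl)
      ultimately show ?thesis by simp
    qed
  qed
qed

lemma riemann_imp_darboux_integrable:
  assumes "is_interval J" "bounded_on_compacts f J" "pre_primitives_are_riemann f J"
  shows "darboux_integrable_on_compacts f J"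
  unfolding darboux_integrable_on_compacts_def
proof (intro allI impI)
  fix a b
  assume ab: "a < b \<and> {a..b} \<subseteq> J"
  then have J: "a \<in> J" "b \<in> J" by auto
  let ?g = "\<lambda>t. - f t"
  have g: "bounded_on_compacts ?g J"
    using assms(2) unfolding bounded_on_compacts_def
    by (simp add: image_image[symmetric])
  let ?L = "darboux_integral f a" and ?U = "\<lambda>x. - darboux_integral ?g a x"
  have "pre_primitive f J ?L" "pre_primitive f J ?U"
    using pre_primitive_signed_lower_integral[OF assms(1) _ J(1)] assms(2) g
    by (auto intro: pre_primitive_uminus)
  then have "(\<lambda>x. ?L x - ?U x) constant_on J"
    using assms(3) unfolding pre_primitives_are_riemann_def by blast
  then obtain k where "\<forall>x\<in>J. ?L x - ?U x = k"
    unfolding constant_on_def by blast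
  then have "?L a - ?U a = k" "?L b - ?U b = k"
    using J by blast+
  then have "Sup (lower_sums f a b) = Inf (upper_sums f a b)"
    using ab by (simp add: darboux_integral_def upper_integral_eq_uminus_lower)
  then show "darboux_integrable f a b"
    using ab assms(2) by (simp add: darboux_integrable_def bounded_on_compacts_def)
qed

theorem theorem7:
  fixes J :: "real set" and f :: "real \<Rightarrow> real"
  assumes "nondegenerate_interval J"
    and "bounded_on_compacts f J"
  shows "(darboux_integrable_on_compacts f J \<longleftrightarrow> pre_primitives_are_riemann f J) \<and>
    (darboux_integrable_on_compacts f J \<longrightarrow>
      (\<forall>a\<in>J. \<forall>b\<in>J. \<forall>F. riemann_primitive f J F \<longrightarrow>
         darboux_integral f a b = F b - F a))"
proof -
  obtain c where J: "is_interval J" and c: "c \<in> J"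
    using assms(1) unfolding nondegenerate_interval_def by blast
  have "pre_primitives_are_riemann f J" if int: "darboux_integrable_on_compacts f J"
    unfolding pre_primitives_are_riemann_def constant_on_def
  proof (intro allI impI exI ballI)
    fix F G x
    assume FG: "pre_primitive f J F \<and> pre_primitive f J G" and x: "x \<in> J"
    then have "darboux_integral f c x = F x - F c" "darboux_integral f c x = G x - G c"
      using darboux_integral_eq_increment[OF J int _ c x] by auto
    then show "F x - G x = F c - G c"
      by linarith
  qed
  then show ?thesis
    using riemann_imp_darboux_integrable[OF J assms(2)] darboux_integral_eq_increment[OF J]
    unfolding riemann_primitive_def by blast
qed

end
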